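(* Let $G$ be a higher pre-category. For any $n\in\mathbb N$ and any cells $f,g$ of $G$ such that $g\star_n f$ is well-defined, given a bi-invertible structure on $f$ and a bi-invertible structure on $g$, one can generate a bi-invertible structure on $g\star_n f$.
   Context: **Globular sets.** The globe category $\mathbb G$ has the natural numbers as objects and morphisms generated by $\sigma_n,\tau_n:n\to n+1$ subject to $\sigma_{n+1}\circ\sigma_n=\tau_{n+1}\circ\sigma_n$ and $\sigma_{n+1}\circ\tau_n=\tau_{n+1}\circ\tau_n$. A globular set $G$ is a presheaf on $\mathbb G$; elements of $G(n)$ are $n$-cells, and for $n$-cells $x,y$ we write $f:x\to y$ for an $(n+1)$-cell $f$ with source $G(\sigma_n)(f)=x$ and target $G(\tau_n)(f)=y$. **Identities and composition.** A globular set with identities and composition is a globular set $G$ with, for each $n$-cell $x$, an $(n+1)$-cell $\mathrm{id}_x:x\to x$, and compositions defined inductively: given $n$-cells $f:x\to y$, $g:y\to z$ there is an $n$-cell $g\star_0 f:x\to z$; given $\alpha:f\to g$ and $\beta:h\to j$ such that $f\star_n h$ and $g\star_n j$ are well-defined, there is a cell $\alpha\star_{n+1}\beta:(f\star_n h)\to(g\star_n j)$. No equations are imposed. **Quasi-invertible structure (coinductive definition).** Let $G$ be a globular set with identities and composition. A quasi-invertible structure on an $n$-cell $f:x\to y$ ($n>0$) is a tuple $(f^{-1},f_R,f_L,f_R^{QI},f_L^{QI})$ where $f^{-1}:y\to x$ is an $n$-cell, $f_R: f\star_0 f^{-1}\to\mathrm{id}_y$ and $f_L:f^{-1}\star_0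 f\to\mathrm{id}_x$ are $(n+1)$-cells, $f_R^{QI}$ is a quasi-invertible structure on $f_R$, and $f_L^{QI}$ is a quasi-invertible structure on $f_L$. **Hom globular sets.** For $n$-cells $x,y$ of $G$ with the same source and target (no condition if $n=0$), $G_{x,y}$ is the globular set whose $0$-cells are the $(n+1)$-cells of $G$ with source $x$ and target $y$, and whose $m$-cells are the $(n+m+1)$-cells of $G$ whose source and target are $(m-1)$-cells of $G_{x,y}$; it inherits identities and composition from $G$. **Graphical calculus.** The usual string diagrams for bicategories are used: areas represent $0$-cells, lines $1$-cells, nodes $2$-cells (read bottom to top, with $1$-cells composed by $\star_0$ placed side by side). A diagram represents a $2$-cell obtained by composing its constituents, with some bracketing and with unitors, associators and their inverses (below) inserted where needed. A globular set respects the graphical calculus if for any well-typed string diagram and any planar isotopy of it there is a $3$-cell from the $2$-cell represented by the source of the isotopy to the $2$-cell represented by its target, and this $3$-cell carries a quasi-invertible structure. **Higher pre-category.** A globular set $G$ with identities and composition such that $G$ and every $G_{x,y}$ respect the graphical calculus, together with the following cells, each equipped with a quasi-invertible structure: for $n>0$ and each $n$-cell $f:x\to y$, unitors $\lambda_f:\mathrm{id}_y\star_0 f\to f$ and $\rho_f:f\star_0\mathrm{id}_x\to f$; for composable $n$-cells $f,g,h$ with $n>0$, an associator $a_{f,g,h}:(f\star_0 g)\star_0 h\to f\star_0(g\star_0 h)$; for compatible cells $f,g,h,j$ and $n>0$, an interchanger $i_{f,g,h,j}:(f\star_n g)\star_0(h\star_n j)\to(f\star_0 h)\star_n(g\star_0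 j)$; for suitable $f,g$ and $n$, a cell $\mathrm{id}_f\star_{n+1}\mathrm{id}_g\to\mathrm{id}_{f\star_n g}$. **Bi-invertible structure (coinductive definition).** For $n>0$, a bi-invertible structure on an $n$-cell $f:x\to y$ is a tuple $(f^\star,{}^\star f,f_R,f_L,f_R^{BI},f_L^{BI})$ where $f^\star:y\to x$ and ${}^\star f:y\to x$ are $n$-cells, $f_R:f\star_0 f^\star\to\mathrm{id}_y$ and $f_L:{}^\star f\star_0 f\to\mathrm{id}_x$ are $(n+1)$-cells, $f_R^{BI}$ is a bi-invertible structure on $f_R$, and $f_L^{BI}$ is a bi-invertible structure on $f_L$. *)

theory Defs
  imports "HOL-Analysis.Analysis"
begin

section \<open>Globular sets with identities and composition\<close>

text \<open>
  All cells live in one type; the dimension is passed explicitly, so the sets \<open>cells G n\<close> need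
  not be disjoint. The maps \<open>src G n\<close> and \<open>tgt G n\<close> go from \<open>(n+1)\<close>-cells to \<open>n\<close>-cells.
\<close>

record 'a globular =
  cells :: "nat \<Rightarrow> 'a set"
  src :: "nat \<Rightarrow> 'a \<Rightarrow> 'a"
  tgt :: "nat \<Rightarrow> 'a \<Rightarrow> 'a"

definition globular_set :: "('a, 'm) globular_scheme \<Rightarrow> bool" where
  "globular_set G \<longleftrightarrow>
     (\<forall>n. \<forall>f \<in> cells G (Suc n). src G n f \<in> cells G n \<and> tgt G n f \<in> cells G n) \<and>
     (\<forall>n. \<forall>f \<in> cells G (Suc (Suc n)).
        src G n (src G (Suc n) f) = src G n (tgt G (Suc n) f) \<and>
        tgt G n (src G (Suc n) f) = tgt G n (tgt G (Suc n) f))"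

definition arrow :: "('a, 'm) globular_scheme \<Rightarrow> nat \<Rightarrow> 'a \<Rightarrow> 'a \<Rightarrow> 'a \<Rightarrow> bool" where
  "arrow G n f x y \<longleftrightarrow> f \<in> cells G (Suc n) \<and> src G n f = x \<and> tgt G n f = y"

text \<open>
  \<open>composable G m n g f\<close>: the composite \<open>g \<star>\<^sub>n f\<close> of two \<open>m\<close>-cells is well-defined. The index \<open>n\<close> counts
  from the top dimension: \<open>\<star>\<^sub>0\<close> composes along the \<open>(m-1)\<close>-dimensional boundary.
\<close>

fun composable :: "('a, 'm) globular_scheme \<Rightarrow> nat \<Rightarrow> nat \<Rightarrow> 'a \<Rightarrow> 'a \<Rightarrow> bool" where
  "composable G 0 n g f \<longleftrightarrow> False"
| "composable G (Suc m) 0 g f \<longleftrightarrow>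
     g \<in> cells G (Suc m) \<and> f \<in> cells G (Suc m) \<and> src G m g = tgt G m f"
| "composable G (Suc m) (Suc n) g f \<longleftrightarrow>
     g \<in> cells G (Suc m) \<and> f \<in> cells G (Suc m) \<and>
     composable G m n (src G m g) (src G m f) \<and> composable G m n (tgt G m g) (tgt G m f)"

text \<open>\<open>idc G n x\<close> is the identity on the \<open>n\<close>-cell \<open>x\<close>; \<open>cmp G m n g f\<close> is \<open>g \<star>\<^sub>n f\<close> for \<open>m\<close>-cells \<open>g\<close>, \<open>f\<close>.\<close>

record 'a globular_comp = "'a globular" +
  idc :: "nat \<Rightarrow> 'a \<Rightarrow> 'a"
  cmp :: "nat \<Rightarrow> nat \<Rightarrow> 'a \<Rightarrow> 'a \<Rightarrow> 'a"

definition globular_set_comp :: "('a, 'm) globular_comp_scheme \<Rightarrow> bool" where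
  "globular_set_comp G \<longleftrightarrow>
     globular_set G \<and>
     (\<forall>n. \<forall>x \<in> cells G n. arrow G n (idc G n x) x x) \<and>
     (\<forall>m g f. composable G (Suc m) 0 g f \<longrightarrow>
        arrow G m (cmp G (Suc m) 0 g f) (src G m f) (tgt G m g)) \<and>
     (\<forall>m n g f. composable G (Suc m) (Suc n) g f \<longrightarrow>
        arrow G m (cmp G (Suc m) (Suc n) g f)
          (cmp G m n (src G m g) (src G m f)) (cmp G m n (tgt G m g) (tgt G m f)))"


section \<open>Invertible structures\<close>

text \<open>
  The codatatypes are the (possibly infinite) trees of raw data; the coinductive predicates say
  when such a tree is a structure on a given cell of a given dimension.
\<close>

codatatype 'a qi_structure =
  QI (qi_inv: 'a) (qi_right: 'a) (qi_left: 'a)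
     (qi_right_str: "'a qi_structure") (qi_left_str: "'a qi_structure")

coinductive quasi_invertible ::
    "('a, 'm) globular_comp_scheme \<Rightarrow> nat \<Rightarrow> 'a \<Rightarrow> 'a qi_structure \<Rightarrow> bool"
  for G :: "('a, 'm) globular_comp_scheme" where
  "\<lbrakk> arrow G n f x y; arrow G n f' y x;
     arrow G (Suc n) r (cmp G (Suc n) 0 f f') (idc G n y);
     arrow G (Suc n) l (cmp G (Suc n) 0 f' f) (idc G n x);
     quasi_invertible G (Suc (Suc n)) r R; quasi_invertible G (Suc (Suc n)) l L \<rbrakk>
   \<Longrightarrow> quasi_invertible G (Suc n) f (QI f' r l R L)"

codatatype 'a bi_structure =
  BI (bi_rinv: 'a) (bi_linv: 'a) (bi_right: 'a) (bi_left: 'a)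
     (bi_right_str: "'a bi_structure") (bi_left_str: "'a bi_structure")

coinductive bi_invertible ::
    "('a, 'm) globular_comp_scheme \<Rightarrow> nat \<Rightarrow> 'a \<Rightarrow> 'a bi_structure \<Rightarrow> bool"
  for G :: "('a, 'm) globular_comp_scheme" where
  "\<lbrakk> arrow G n f x y; arrow G n f' y x; arrow G n f'' y x;
     arrow G (Suc n) r (cmp G (Suc n) 0 f f') (idc G n y);
     arrow G (Suc n) l (cmp G (Suc n) 0 f'' f) (idc G n x);
     bi_invertible G (Suc (Suc n)) r R; bi_invertible G (Suc (Suc n)) l L \<rbrakk>
   \<Longrightarrow> bi_invertible G (Suc n) f (BI f' f'' r l R L)"


section \<open>Coherence cells\<close>

text \<open>
  The first argument of each coherence cell is the dimension of the cells it is applied to;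
  \<open>ichg G m n f g h j\<close> and \<open>idcmp G m n f g\<close> also take the index \<open>n\<close> of the composition involved.
  The fields with suffix \<open>_qi\<close> hold the quasi-invertible structures.
\<close>

record 'a higher_data = "'a globular_comp" +
  lunit :: "nat \<Rightarrow> 'a \<Rightarrow> 'a"
  lunit_qi :: "nat \<Rightarrow> 'a \<Rightarrow> 'a qi_structure"
  runit :: "nat \<Rightarrow> 'a \<Rightarrow> 'a"
  runit_qi :: "nat \<Rightarrow> 'a \<Rightarrow> 'a qi_structure"
  assoc :: "nat \<Rightarrow> 'a \<Rightarrow> 'a \<Rightarrow> 'a \<Rightarrow> 'a"
  assoc_qi :: "nat \<Rightarrow> 'a \<Rightarrow> 'a \<Rightarrow> 'a \<Rightarrow> 'a qi_structure"
  ichg :: "nat \<Rightarrow> nat \<Rightarrow> 'a \<Rightarrow> 'a \<Rightarrow> 'a \<Rightarrow> 'a \<Rightarrow> 'a"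
  ichg_qi :: "nat \<Rightarrow> nat \<Rightarrow> 'a \<Rightarrow> 'a \<Rightarrow> 'a \<Rightarrow> 'a \<Rightarrow> 'a qi_structure"
  idcmp :: "nat \<Rightarrow> nat \<Rightarrow> 'a \<Rightarrow> 'a \<Rightarrow> 'a"
  idcmp_qi :: "nat \<Rightarrow> nat \<Rightarrow> 'a \<Rightarrow> 'a \<Rightarrow> 'a qi_structure"

definition qi_arrow ::
    "('a, 'm) globular_comp_scheme \<Rightarrow> nat \<Rightarrow> 'a \<Rightarrow> 'a \<Rightarrow> 'a \<Rightarrow> 'a qi_structure \<Rightarrow> bool" where
  "qi_arrow G n f x y Q \<longleftrightarrow> arrow G n f x y \<and> quasi_invertible G (Suc n) f Q"

definition has_unitors :: "'a higher_data \<Rightarrow> bool" where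
  "has_unitors G \<longleftrightarrow> (\<forall>n f x y. arrow G n f x y \<longrightarrow>
     qi_arrow G (Suc n) (lunit G (Suc n) f)
       (cmp G (Suc n) 0 (idc G n y) f) f (lunit_qi G (Suc n) f) \<and>
     qi_arrow G (Suc n) (runit G (Suc n) f)
       (cmp G (Suc n) 0 f (idc G n x)) f (runit_qi G (Suc n) f))"

definition has_associators :: "'a higher_data \<Rightarrow> bool" where
  "has_associators G \<longleftrightarrow> (\<forall>n f g h. composable G n 0 f g \<and> composable G n 0 g h \<longrightarrow>
     qi_arrow G n (assoc G n f g h)
       (cmp G n 0 (cmp G n 0 f g) h) (cmp G n 0 f (cmp G n 0 g h)) (assoc_qi G n f g h))"

definition has_interchangers :: "'a higher_data \<Rightarrow> bool" where
  "has_interchangers G \<longleftrightarrow> (\<forall>m n f g h j.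
     0 < n \<and> composable G m n f g \<and> composable G m n h j \<and>
     composable G m 0 f h \<and> composable G m 0 g j \<longrightarrow>
     qi_arrow G m (ichg G m n f g h j)
       (cmp G m 0 (cmp G m n f g) (cmp G m n h j))
       (cmp G m n (cmp G m 0 f h) (cmp G m 0 g j)) (ichg_qi G m n f g h j))"

definition has_identity_composites :: "'a higher_data \<Rightarrow> bool" where
  "has_identity_composites G \<longleftrightarrow> (\<forall>m n f g. composable G m n f g \<longrightarrow>
     qi_arrow G (Suc m) (idcmp G m n f g)
       (cmp G (Suc m) (Suc n) (idc G m f) (idc G m g)) (idc G m (cmp G m n f g))
       (idcmp_qi G m n f g))"


section \<open>Hom globular sets\<close>

definition parallel :: "('a, 'm) globular_scheme \<Rightarrow> nat \<Rightarrow> 'a \<Rightarrow> 'a \<Rightarrow> bool" where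
  "parallel G n x y \<longleftrightarrow> x \<in> cells G n \<and> y \<in> cells G n \<and>
     (\<forall>k. n = Suc k \<longrightarrow> src G k x = src G k y \<and> tgt G k x = tgt G k y)"

fun hom_cells :: "('a, 'm) globular_scheme \<Rightarrow> nat \<Rightarrow> 'a \<Rightarrow> 'a \<Rightarrow> nat \<Rightarrow> 'a set" where
  "hom_cells G n x y 0 = {f. arrow G n f x y}"
| "hom_cells G n x y (Suc m) = {f \<in> cells G (n + Suc m + 1).
     src G (n + m + 1) f \<in> hom_cells G n x y m \<and> tgt G (n + m + 1) f \<in> hom_cells G n x y m}"

definition hom_set :: "'a higher_data \<Rightarrow> nat \<Rightarrow> 'a \<Rightarrow> 'a \<Rightarrow> 'a higher_data" where
  "hom_set G n x y = \<lparr>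
     cells = hom_cells G n x y,
     src = (\<lambda>m. src G (n + m + 1)),
     tgt = (\<lambda>m. tgt G (n + m + 1)),
     idc = (\<lambda>m. idc G (n + m + 1)),
     cmp = (\<lambda>m. cmp G (n + m + 1)),
     lunit = (\<lambda>m. lunit G (n + m + 1)),
     lunit_qi = (\<lambda>m. lunit_qi G (n + m + 1)),
     runit = (\<lambda>m. runit G (n + m + 1)),
     runit_qi = (\<lambda>m. runit_qi G (n + m + 1)),
     assoc = (\<lambda>m. assoc G (n + m + 1)),
     assoc_qi = (\<lambda>m. assoc_qi G (n + m + 1)),
     ichg = (\<lambda>m. ichg G (n + m + 1)),
     ichg_qi = (\<lambda>m. ichg_qi G (n + m + 1)),
     idcmp = (\<lambda>m. idcmp G (n + m + 1)),
     idcmp_qi = (\<lambda>m. idcmp_qi G (n + m + 1)) \<rparr>"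


section \<open>String diagrams\<close>

text \<open>
  A bracketed word of lines, read from left to right in the order in which \<open>\<star>\<^sub>0\<close> is written:
  \<open>Beside s t\<close> stands for \<open>s \<star>\<^sub>0 t\<close>, so a line has its target area on its left and its source area
  on its right. \<open>Void x\<close> is the identity on the \<open>0\<close>-cell \<open>x\<close>, which is not drawn.
\<close>

datatype 'a word = Line 'a | Void 'a | Beside "'a word" "'a word"

fun line_list :: "'a word \<Rightarrow> 'a list" where
  "line_list (Line f) = [f]"
| "line_list (Void x) = []"
| "line_list (Beside s t) = line_list s @ line_list t"

fun word_cell :: "('a, 'm) globular_comp_scheme \<Rightarrow> 'a word \<Rightarrow> 'a" where
  "word_cell G (Line f) = f"
| "word_cell G (Void x) = idc G 0 x"
| "word_cell G (Beside s t) = cmp G 1 0 (word_cell G s) (word_cell G t)"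

fun wf_word :: "('a, 'm) globular_comp_scheme \<Rightarrow> 'a word \<Rightarrow> bool" where
  "wf_word G (Line f) \<longleftrightarrow> f \<in> cells G 1"
| "wf_word G (Void x) \<longleftrightarrow> x \<in> cells G 0"
| "wf_word G (Beside s t) \<longleftrightarrow> wf_word G s \<and> wf_word G t \<and>
     composable G 1 0 (word_cell G s) (word_cell G t)"

abbreviation word_src :: "('a, 'm) globular_comp_scheme \<Rightarrow> 'a word \<Rightarrow> 'a" where
  "word_src G s \<equiv> src G 0 (word_cell G s)"

abbreviation word_tgt :: "('a, 'm) globular_comp_scheme \<Rightarrow> 'a word \<Rightarrow> 'a" where
  "word_tgt G s \<equiv> tgt G 0 (word_cell G s)"

text \<open>
  A progressive plane diagram, in the sense of Joyal and Street, in the strip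
  \<open>UNIV \<times> {base D..roof D}\<close>; the second coordinate is the height. The edge \<open>e\<close> is the curve of points
  \<open>(xpos D e u, u)\<close> for \<open>lo D e \<le> u \<le> hi D e\<close>, so that it never runs horizontally or turns back. A
  node label \<open>(s, a, t)\<close> consists of a \<open>2\<close>-cell \<open>a\<close> together with the way in which its source and
  target are parsed as words of lines. The label of an area is read off at any of its points.
\<close>

record 'a diagram =
  base :: real
  roof :: real
  nodes :: "nat set"
  edges :: "nat set"
  npos :: "nat \<Rightarrow> real \<times> real"
  lo :: "nat \<Rightarrow> real"
  hi :: "nat \<Rightarrow> real"
  xpos :: "nat \<Rightarrow> real \<Rightarrow> real"
  node_label :: "nat \<Rightarrow> 'a word \<times> 'a \<times> 'a word"
  edge_label :: "nat \<Rightarrow> 'a"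
  area_label :: "real \<times> real \<Rightarrow> 'a"

definition drawing :: "'a diagram \<Rightarrow> (real \<times> real) set" where
  "drawing D = npos D ` nodes D \<union> (\<Union>e \<in> edges D. (\<lambda>u. (xpos D e u, u)) ` {lo D e..hi D e})"

definition areas :: "'a diagram \<Rightarrow> (real \<times> real) set" where
  "areas D = UNIV \<times> {base D..roof D} - drawing D"

definition ends_at :: "'a diagram \<Rightarrow> nat \<Rightarrow> nat \<Rightarrow> bool" where
  "ends_at D e v \<longleftrightarrow> npos D v = (xpos D e (hi D e), hi D e)"

definition starts_at :: "'a diagram \<Rightarrow> nat \<Rightarrow> nat \<Rightarrow> bool" where
  "starts_at D e v \<longleftrightarrow> npos D v = (xpos D e (lo D e), lo D e)"

definition plane_graph :: "'a diagram \<Rightarrow> bool" where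
  "plane_graph D \<longleftrightarrow>
     base D < roof D \<and> finite (nodes D) \<and> finite (edges D) \<and> inj_on (npos D) (nodes D) \<and>
     (\<forall>v \<in> nodes D. base D < snd (npos D v) \<and> snd (npos D v) < roof D) \<and>
     (\<forall>e \<in> edges D.
        base D \<le> lo D e \<and> lo D e < hi D e \<and> hi D e \<le> roof D \<and>
        continuous_on {lo D e..hi D e} (xpos D e) \<and>
        (lo D e = base D \<or> (\<exists>v \<in> nodes D. starts_at D e v)) \<and>
        (hi D e = roof D \<or> (\<exists>v \<in> nodes D. ends_at D e v)) \<and>
        (\<forall>u \<in> {lo D e<..<hi D e}. (xpos D e u, u) \<notin> npos D ` nodes D)) \<and>
     (\<forall>d \<in> edges D. \<forall>e \<in> edges D. \<forall>u \<in> {lo D d..hi D d} \<inter> {lo D e..hi D e}.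
        d \<noteq> e \<and> xpos D d u = xpos D e u \<longrightarrow> (xpos D e u, u) \<in> npos D ` nodes D)"

text \<open>
  \<open>labels_along D E ltr fs\<close>: the edges in \<open>E\<close>, listed from left to right according to \<open>ltr\<close>, have
  labels \<open>fs\<close>.
\<close>

definition labels_along :: "'a diagram \<Rightarrow> nat set \<Rightarrow> (nat \<Rightarrow> nat \<Rightarrow> bool) \<Rightarrow> 'a list \<Rightarrow> bool" where
  "labels_along D E ltr fs \<longleftrightarrow>
     (\<exists>es. distinct es \<and> set es = E \<and> sorted_wrt ltr es \<and> map (edge_label D) es = fs)"

definition well_typed_edge :: "'a higher_data \<Rightarrow> 'a diagram \<Rightarrow> nat \<Rightarrow> bool" where
  "well_typed_edge G D e \<longleftrightarrow> edge_label D e \<in> cells G 1 \<and>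
     (\<forall>u \<in> {lo D e<..<hi D e}. \<forall>\<^sub>F d in at_right 0.
        area_label D (xpos D e u - d, u) = tgt G 0 (edge_label D e) \<and>
        area_label D (xpos D e u + d, u) = src G 0 (edge_label D e))"

definition well_typed_node :: "'a higher_data \<Rightarrow> 'a diagram \<Rightarrow> nat \<Rightarrow> bool" where
  "well_typed_node G D v \<longleftrightarrow>
     (case npos D v of (x, u) \<Rightarrow> case node_label D v of (s, a, t) \<Rightarrow>
        wf_word G s \<and> wf_word G t \<and> arrow G 1 a (word_cell G s) (word_cell G t) \<and>
        labels_along D {e \<in> edges D. ends_at D e v}
          (\<lambda>d e. \<forall>\<^sub>F w in at_left u. xpos D d w < xpos D e w) (line_list s) \<and>
        labels_along D {e \<in> edges D. starts_at D e v}
          (\<lambda>d e. \<forall>\<^sub>F w in at_right u. xpos D d w < xpos D e w) (line_list t) \<and>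
        (\<forall>\<^sub>F d in at_right 0.
           area_label D (x - d, u) = word_tgt G s \<and> area_label D (x + d, u) = word_src G s))"

definition well_typed :: "'a higher_data \<Rightarrow> 'a diagram \<Rightarrow> bool" where
  "well_typed G D \<longleftrightarrow> plane_graph D \<and>
     (\<forall>p \<in> areas D. area_label D p \<in> cells G 0) \<and>
     (\<forall>p q. connected_component (areas D) p q \<longrightarrow> area_label D p = area_label D q) \<and>
     (\<forall>e \<in> edges D. well_typed_edge G D e) \<and>
     (\<forall>v \<in> nodes D. well_typed_node G D v)"

text \<open>
  An isotopy is a continuous deformation of a labelled diagram through well-typed diagrams. As the
  nodes and edges are finite in number, continuity forces their incidences to be preserved. The last
  clause says that the labels of the areas are carried along.
\<close>

definition isotopy :: "'a higher_data \<Rightarrow> (real \<Rightarrow> 'a diagram) \<Rightarrow> bool" where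
  "isotopy G D \<longleftrightarrow>
     (\<forall>t \<in> {0..1}. well_typed G (D t) \<and>
        base (D t) = base (D 0) \<and> roof (D t) = roof (D 0) \<and>
        nodes (D t) = nodes (D 0) \<and> edges (D t) = edges (D 0) \<and>
        (\<forall>v \<in> nodes (D 0). node_label (D t) v = node_label (D 0) v) \<and>
        (\<forall>e \<in> edges (D 0). edge_label (D t) e = edge_label (D 0) e)) \<and>
     (\<forall>v \<in> nodes (D 0). continuous_on {0..1} (\<lambda>t. npos (D t) v)) \<and>
     (\<forall>e \<in> edges (D 0).
        continuous_on {0..1} (\<lambda>t. lo (D t) e) \<and> continuous_on {0..1} (\<lambda>t. hi (D t) e) \<and>
        continuous_on {(t, u). t \<in> {0..1} \<and> u \<in> {lo (D t) e..hi (D t) e}}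
          (\<lambda>(t, u). xpos (D t) e u)) \<and>
     (\<forall>t p t' p'. connected_component {(t, p). t \<in> {0..1} \<and> p \<in> areas (D t)} (t, p) (t', p') \<longrightarrow>
        area_label (D t) p = area_label (D t') p')"


section \<open>The \<open>2\<close>-cells represented by a diagram\<close>

definition slab :: "'a diagram \<Rightarrow> real \<Rightarrow> real \<Rightarrow> 'a diagram" where
  "slab D a b = D \<lparr> base := a, roof := b,
     nodes := {v \<in> nodes D. a < snd (npos D v) \<and> snd (npos D v) < b},
     edges := {e \<in> edges D. lo D e < b \<and> a < hi D e},
     lo := (\<lambda>e. max a (lo D e)), hi := (\<lambda>e. min b (hi D e)) \<rparr>"

text \<open>
  The parts of a diagram on either side of a curve \<open>x = c u\<close> that runs inside the areas from the base
  to the roof. The area meeting the curve is extended to fill the other side of the strip.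
\<close>

definition separates :: "'a diagram \<Rightarrow> (real \<Rightarrow> real) \<Rightarrow> bool" where
  "separates D c \<longleftrightarrow> continuous_on {base D..roof D} c \<and> (\<forall>u \<in> {base D..roof D}. (c u, u) \<in> areas D)"

definition left_part :: "'a diagram \<Rightarrow> (real \<Rightarrow> real) \<Rightarrow> 'a diagram" where
  "left_part D c = D \<lparr>
     nodes := {v \<in> nodes D. fst (npos D v) < c (snd (npos D v))},
     edges := {e \<in> edges D. \<forall>u \<in> {lo D e..hi D e}. xpos D e u < c u},
     area_label := (\<lambda>(x, u). area_label D (min x (c u), u)) \<rparr>"

definition right_part :: "'a diagram \<Rightarrow> (real \<Rightarrow> real) \<Rightarrow> 'a diagram" where
  "right_part D c = D \<lparr>
     nodes := {v \<in> nodes D. c (snd (npos D v)) < fst (npos D v)},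
     edges := {e \<in> edges D. \<forall>u \<in> {lo D e..hi D e}. c u < xpos D e u},
     area_label := (\<lambda>(x, u). area_label D (max x (c u), u)) \<rparr>"

text \<open>The word \<open>s\<close> is a bracketing of the lines met by the base of \<open>D\<close>.\<close>

definition base_word :: "'a higher_data \<Rightarrow> 'a diagram \<Rightarrow> 'a word \<Rightarrow> bool" where
  "base_word G D s \<longleftrightarrow> wf_word G s \<and>
     labels_along D {e \<in> edges D. lo D e = base D}
       (\<lambda>d e. xpos D d (base D) < xpos D e (base D)) (line_list s) \<and>
     (\<forall>\<^sub>F x in at_bot. area_label D (x, base D) = word_tgt G s)"

text \<open>The \<open>2\<close>-cells that may be inserted without being drawn.\<close>

inductive structural :: "'a higher_data \<Rightarrow> 'a word \<Rightarrow> 'a word \<Rightarrow> 'a \<Rightarrow> bool"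
  for G :: "'a higher_data" where
  identity: "structural G s s (idc G 1 (word_cell G s))"
| left_unitor:
    "structural G (Beside (Void (word_tgt G s)) s) s (lunit G 1 (word_cell G s))"
| left_unitor_inv:
    "structural G s (Beside (Void (word_tgt G s)) s) (qi_inv (lunit_qi G 1 (word_cell G s)))"
| right_unitor:
    "structural G (Beside s (Void (word_src G s))) s (runit G 1 (word_cell G s))"
| right_unitor_inv:
    "structural G s (Beside s (Void (word_src G s))) (qi_inv (runit_qi G 1 (word_cell G s)))"
| associator:
    "structural G (Beside (Beside r s) t) (Beside r (Beside s t))
       (assoc G 1 (word_cell G r) (word_cell G s) (word_cell G t))"
| associator_inv:
    "structural G (Beside r (Beside s t)) (Beside (Beside r s) t)
       (qi_inv (assoc_qi G 1 (word_cell G r) (word_cell G s) (word_cell G t)))"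

text \<open>
  \<open>represents G D s t a\<close>: the well-typed diagram \<open>D\<close>, with its base bracketed as \<open>s\<close> and its roof as
  \<open>t\<close>, represents the \<open>2\<close>-cell \<open>a\<close>. The bracketings are recorded since a diagram only determines the
  source and target of the \<open>2\<close>-cells it represents up to rebracketing.
\<close>

inductive represents ::
    "'a higher_data \<Rightarrow> 'a diagram \<Rightarrow> 'a word \<Rightarrow> 'a word \<Rightarrow> 'a \<Rightarrow> bool"
  for G :: "'a higher_data" where
  only_lines:
    "\<lbrakk> nodes D = {}; base_word G D s; structural G s t a \<rbrakk> \<Longrightarrow> represents G D s t a"
| single_node:
    "\<lbrakk> nodes D = {v}; \<And>e. e \<in> edges D \<Longrightarrow> starts_at D e v \<or> ends_at D e v;
       node_label D v = (s, a, t) \<rbrakk> \<Longrightarrow> represents G D s t a"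
| stacked:
    "\<lbrakk> base D < u; u < roof D; \<And>v. v \<in> nodes D \<Longrightarrow> snd (npos D v) \<noteq> u;
       represents G (slab D (base D) u) r s a; represents G (slab D u (roof D)) s t b \<rbrakk>
     \<Longrightarrow> represents G D r t (cmp G 2 0 b a)"
| side_by_side:
    "\<lbrakk> separates D c;
       represents G (left_part D c) s t a; represents G (right_part D c) s' t' b \<rbrakk>
     \<Longrightarrow> represents G D (Beside s s') (Beside t t') (cmp G 2 1 a b)"

definition respects_graphical_calculus :: "'a higher_data \<Rightarrow> bool" where
  "respects_graphical_calculus G \<longleftrightarrow>
     (\<forall>D s t a b. isotopy G D \<and> represents G (D 0) s t a \<and> represents G (D 1) s t b \<longrightarrow>
        (\<exists>h Q. qi_arrow G 2 h a b Q))"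


section \<open>Higher pre-categories\<close>

definition higher_pre_category :: "'a higher_data \<Rightarrow> bool" where
  "higher_pre_category G \<longleftrightarrow>
     globular_set_comp G \<and>
     has_unitors G \<and> has_associators G \<and> has_interchangers G \<and> has_identity_composites G \<and>
     respects_graphical_calculus G \<and>
     (\<forall>n x y. parallel G n x y \<longrightarrow> respects_graphical_calculus (hom_set G n x y))"

end

(* Close the bi-invertible cells under all compositions. A composite in this closure has componentwise
   inverses (in the opposite order for index 0), and the cells cancelling them are composites of the
   given cancelling cells, identities and coherence cells, so they lie in the closure again. By
   coinduction, every cell of the closure is bi-invertible. *)

theory Submission imports Defs begin

section \<open>Coinduction for the existence of bi-invertible structures\<close>

text \<open>The function \<open>w\<close> picks two inverses and two cancelling cells for a cell of
  dimension \<open>m\<close>. The cancelling cells have dimension \<open>m + 1\<close>, hence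
  \<open>Suc m\<close> in both subtrees.\<close>

primcorec bi_unfold :: "(nat \<Rightarrow> 'a \<Rightarrow> 'a \<times> 'a \<times> 'a \<times> 'a) \<Rightarrow> nat \<Rightarrow> 'a \<Rightarrow> 'a bi_structure" where
  "bi_unfold w m f = (case w m f of (f', f'', r, l) \<Rightarrow>
     BI f' f'' r l (bi_unfold w (Suc m) r) (bi_unfold w (Suc m) l))"

text \<open>One unfolding of \<open>bi_invertible\<close>, with \<open>X\<close> in place of the
  structures on the two cancelling cells.\<close>

definition bi_step ::
    "('a, 'm) globular_comp_scheme \<Rightarrow> (nat \<Rightarrow> 'a \<Rightarrow> bool) \<Rightarrow> nat \<Rightarrow> 'a \<Rightarrow> 'a \<times> 'a \<times> 'a \<times> 'a \<Rightarrow> bool" where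
  "bi_step G X m f = (\<lambda>(f', f'', r, l). \<exists>n x y. m = Suc n \<and>
     arrow G n f x y \<and> arrow G n f' y x \<and> arrow G n f'' y x \<and>
     arrow G (Suc n) r (cmp G (Suc n) 0 f f') (idc G n y) \<and>
     arrow G (Suc n) l (cmp G (Suc n) 0 f'' f) (idc G n x) \<and>
     X (Suc (Suc n)) r \<and> X (Suc (Suc n)) l)"

text \<open>Choosing the data of one step for all cells of \<open>X\<close> at once gives
  \<open>w\<close>, and the tree unfolded from \<open>w\<close> is a structure on every cell of
  \<open>X\<close>.\<close>

lemma bi_invertible_coinduct_ex:
  assumes "X m f" and step: "\<And>m f. X m f \<Longrightarrow> \<exists>w. bi_step G X m f w"
  shows "\<exists>H. bi_invertible G m f H"
proof -
  obtain w where w: "\<And>m f. X m f \<Longrightarrow> bi_step G X m f (w m f)"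
    using step by metis
  have "bi_invertible G m f (bi_unfold w m f)"
    using \<open>X m f\<close>
  proof (coinduction arbitrary: m f)
    case bi_invertible
    obtain f' f'' r l where eq: "w m f = (f', f'', r, l)" by (cases "w m f")
    have "bi_unfold w m f = BI f' f'' r l (bi_unfold w (Suc m) r) (bi_unfold w (Suc m) l)"
      by (subst bi_unfold.code) (simp add: eq)
    with w[OF bi_invertible] show ?case unfolding bi_step_def eq by auto
  qed
  then show ?thesis by blast
qed

section \<open>Quasi-invertible cells as bi-invertible cells\<close>

text \<open>The single inverse of a quasi-invertible structure serves as both inverses, at every
  level of the tree.\<close>

lemma quasi_invertible_imp_bi_invertible:
  assumes "quasi_invertible G m f Q"
  shows "\<exists>H. bi_invertible G m f H"
proof (rule bi_invertible_coinduct_ex[where X = "\<lambda>m f. \<exists>Q. quasi_invertible G m f Q"])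
  show "\<exists>Q. quasi_invertible G m f Q" using assms by blast
next
  fix m f assume "\<exists>Q. quasi_invertible G m f Q"
  then obtain Q where "quasi_invertible G m f Q" by blast
  then show "\<exists>w. bi_step G (\<lambda>m f. \<exists>Q. quasi_invertible G m f Q) m f w"
  proof cases
    case (1 n x y f' r l R L)
    then show ?thesis by (intro exI[of _ "(f', f', r, l)"]) (auto simp: bi_step_def)
  qed
qed

text \<open>The inverse has \<open>f\<close> as its own inverse, with the cancelling cells
  exchanged: \<open>l\<close> cancels it on the right and \<open>r\<close> on the left.\<close>

lemma quasi_invertible_inv:
  assumes "qi_arrow G n f x y Q"
  shows "\<exists>Q'. qi_arrow G n (qi_inv Q) y x Q'"
proof -
  have f: "arrow G n f x y" and q: "quasi_invertible G (Suc n) f Q"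
    using assms by (auto simp: qi_arrow_def)
  from q show ?thesis
  proof cases
    case (1 x' y' f' r l R L)
    then have "x' = x" "y' = y" using f by (auto simp: arrow_def)
    with 1 f have "qi_arrow G n (qi_inv Q) y x (QI f l r L R)"
      by (auto simp: qi_arrow_def intro!: quasi_invertible.intros)
    then show ?thesis by blast
  qed
qed

section \<open>The closure of the bi-invertible cells under composition\<close>

inductive bi_closure :: "'a higher_data \<Rightarrow> nat \<Rightarrow> 'a \<Rightarrow> bool" for G :: "'a higher_data" where
  base: "bi_invertible G m f F \<Longrightarrow> bi_closure G m f"
| comp: "\<lbrakk>composable G m n g f; bi_closure G m g; bi_closure G m f\<rbrakk> \<Longrightarrow> bi_closure G m (cmp G m n g f)"

definition bi_arrow :: "'a higher_data \<Rightarrow> nat \<Rightarrow> 'a \<Rightarrow> 'a \<Rightarrow> 'a \<Rightarrow> bool" where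
  "bi_arrow G n f x y \<longleftrightarrow> arrow G n f x y \<and> bi_closure G (Suc n) f"

lemma qi_arrow_imp_bi_arrow: "qi_arrow G n f x y Q \<Longrightarrow> bi_arrow G n f x y"
  using quasi_invertible_imp_bi_invertible
  by (fastforce simp: qi_arrow_def bi_arrow_def intro: bi_closure.base)

lemma qi_arrow_imp_bi_arrow_inv: "qi_arrow G n f x y Q \<Longrightarrow> bi_arrow G n (qi_inv Q) y x"
  using quasi_invertible_inv qi_arrow_imp_bi_arrow by metis

lemma composable_0_if_arrows: "arrow G n f x y \<Longrightarrow> arrow G n g y z \<Longrightarrow> composable G (Suc n) 0 g f"
  by (auto simp: arrow_def)

lemma composable_Suc_if_arrows:
  "arrow G m f x y \<Longrightarrow> arrow G m g x' y' \<Longrightarrow> composable G m n x' x \<Longrightarrow> composable G m n y' y \<Longrightarrow>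
    composable G (Suc m) (Suc n) g f"
  by (auto simp: arrow_def)

locale pre_category_cells =
  fixes G :: "'a higher_data"
  assumes pre_category: "higher_pre_category G"
begin

lemma arrow_ends:
  assumes "arrow G n f x y"
  shows "x \<in> cells G n" "y \<in> cells G n"
  using assms pre_category
  by (auto simp: higher_pre_category_def globular_set_comp_def globular_set_def arrow_def)

lemma arrow_idc: "x \<in> cells G n \<Longrightarrow> arrow G n (idc G n x) x x"
  using pre_category by (auto simp: higher_pre_category_def globular_set_comp_def)

lemma arrow_cmp_0:
  "arrow G n f x y \<Longrightarrow> arrow G n g y z \<Longrightarrow> arrow G n (cmp G (Suc n) 0 g f) x z"
  using pre_category composable_0_if_arrows[of G n f x y g z]
  unfolding higher_pre_category_def globular_set_comp_def arrow_def[of G n f] arrow_def[of G n g]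
  by metis

lemma arrow_cmp_Suc:
  "arrow G m f x y \<Longrightarrow> arrow G m g x' y' \<Longrightarrow> composable G m n x' x \<Longrightarrow> composable G m n y' y \<Longrightarrow>
    arrow G m (cmp G (Suc m) (Suc n) g f) (cmp G m n x' x) (cmp G m n y' y)"
  using pre_category composable_Suc_if_arrows[of G m f x y g x' y' n]
  unfolding higher_pre_category_def globular_set_comp_def arrow_def[of G m f] arrow_def[of G m g]
  by metis

lemma bi_arrow_cmp_0:
  "bi_arrow G n f x y \<Longrightarrow> bi_arrow G n g y z \<Longrightarrow> bi_arrow G n (cmp G (Suc n) 0 g f) x z"
  unfolding bi_arrow_def by (auto intro: arrow_cmp_0 bi_closure.comp composable_0_if_arrows)

text \<open>The existential form allows chains of coherence and cancelling cells to be composed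
  without naming the result.\<close>

lemma bi_arrow_trans:
  "\<exists>a. bi_arrow G n a x y \<Longrightarrow> \<exists>b. bi_arrow G n b y z \<Longrightarrow> \<exists>c. bi_arrow G n c x z"
  by (blast intro: bi_arrow_cmp_0)

lemma bi_arrow_cmp_Suc:
  "bi_arrow G m f x y \<Longrightarrow> bi_arrow G m g x' y' \<Longrightarrow> composable G m n x' x \<Longrightarrow> composable G m n y' y \<Longrightarrow>
    bi_arrow G m (cmp G (Suc m) (Suc n) g f) (cmp G m n x' x) (cmp G m n y' y)"
  unfolding bi_arrow_def by (auto intro: arrow_cmp_Suc bi_closure.comp composable_Suc_if_arrows)

lemma bi_arrow_lunit:
  "arrow G n f x y \<Longrightarrow> bi_arrow G (Suc n) (lunit G (Suc n) f) (cmp G (Suc n) 0 (idc G n y) f) f"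
  using pre_category unfolding higher_pre_category_def has_unitors_def
  by (blast intro: qi_arrow_imp_bi_arrow)

text \<open>The second direction is the inverse taken from the quasi-invertible structure on the
  associator, which is quasi-invertible itself.\<close>

lemma bi_arrow_assoc:
  assumes "arrow G n h w x" "arrow G n g x y" "arrow G n f y z"
  shows "\<exists>a. bi_arrow G (Suc n) a (cmp G (Suc n) 0 (cmp G (Suc n) 0 f g) h)
           (cmp G (Suc n) 0 f (cmp G (Suc n) 0 g h))"
    and "\<exists>a. bi_arrow G (Suc n) a (cmp G (Suc n) 0 f (cmp G (Suc n) 0 g h))
           (cmp G (Suc n) 0 (cmp G (Suc n) 0 f g) h)"
  using pre_category composable_0_if_arrows[OF assms(1,2)] composable_0_if_arrows[OF assms(2,3)]
  unfolding higher_pre_category_def has_associators_def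
  by (blast intro: qi_arrow_imp_bi_arrow qi_arrow_imp_bi_arrow_inv)+

text \<open>An identity is its own inverse on both sides: the left unitor at the identity goes from
  its square to itself, so it is both cancelling cells.\<close>

lemma bi_arrow_idc:
  assumes "x \<in> cells G n"
  shows "bi_arrow G n (idc G n x) x x"
proof -
  let ?i = "idc G n x"
  have i: "arrow G n ?i x x" using assms by (rule arrow_idc)
  then have q: "qi_arrow G (Suc n) (lunit G (Suc n) ?i) (cmp G (Suc n) 0 ?i ?i) ?i
      (lunit_qi G (Suc n) ?i)"
    using pre_category by (auto simp: higher_pre_category_def has_unitors_def)
  then obtain L where "bi_invertible G (Suc (Suc n)) (lunit G (Suc n) ?i) L"
    unfolding qi_arrow_def by (blast dest: quasi_invertible_imp_bi_invertible)
  with q i have "bi_invertible G (Suc n) ?i (BI ?i ?i (lunit G (Suc n) ?i) (lunit G (Suc n) ?i) L L)"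
    by (auto simp: qi_arrow_def intro!: bi_invertible.intros)
  with i show ?thesis unfolding bi_arrow_def by (blast intro: bi_closure.base)
qed

text \<open>The cell is the \<open>\<star>\<^sub>1\<close>-composite of the identity on
  \<open>g\<close> with \<open>a\<close>, and identities belong to the closure.\<close>

lemma bi_arrow_whisker_left:
  assumes "bi_arrow G (Suc n) a f f'" "arrow G n f x y" "arrow G n f' x y" "arrow G n g y z"
  shows "\<exists>b. bi_arrow G (Suc n) b (cmp G (Suc n) 0 g f) (cmp G (Suc n) 0 g f')"
  using bi_arrow_cmp_Suc[OF assms(1) bi_arrow_idc[of g]] assms(2-4)
  by (blast intro: composable_0_if_arrows dest: arrow_def[THEN iffD1])

lemma bi_arrow_whisker_right:
  assumes "bi_arrow G (Suc n) a g g'" "arrow G n g y z" "arrow G n g' y z" "arrow G n f x y"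
  shows "\<exists>b. bi_arrow G (Suc n) b (cmp G (Suc n) 0 g f) (cmp G (Suc n) 0 g' f)"
  using bi_arrow_cmp_Suc[OF bi_arrow_idc[of f] assms(1)] assms(2-4)
  by (blast intro: composable_0_if_arrows dest: arrow_def[THEN iffD1])

section \<open>Cancelling cells for composites\<close>

text \<open>Writing \<open>\<star>\<^sub>0\<close> as juxtaposition, the chain is
  \<open>(g f)(f' g')\<close>, \<open>g (f (f' g'))\<close>, \<open>g ((f f') g')\<close>,
  \<open>g (id g')\<close>, \<open>g g'\<close>, \<open>id\<close>: reassociate, cancel the inner
  pair by \<open>a\<close>, remove the unit, cancel the outer pair by \<open>b\<close>.\<close>

lemma bi_arrow_cancel_0:
  assumes f: "arrow G n f x y" and f': "arrow G n f' y x"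
    and g: "arrow G n g y z" and g': "arrow G n g' z y"
    and a: "bi_arrow G (Suc n) a (cmp G (Suc n) 0 f f') (idc G n y)"
    and b: "bi_arrow G (Suc n) b (cmp G (Suc n) 0 g g') (idc G n z)"
  shows "\<exists>c. bi_arrow G (Suc n) c
    (cmp G (Suc n) 0 (cmp G (Suc n) 0 g f) (cmp G (Suc n) 0 f' g')) (idc G n z)"
proof -
  note ar = f f' g g' arrow_cmp_0 arrow_idc[OF arrow_ends(2)[OF f]]
  let ?c = "cmp G (Suc n) 0"
  have "\<exists>c. bi_arrow G (Suc n) c (?c (?c g f) (?c f' g')) (?c g (?c f (?c f' g')))"
    by (rule bi_arrow_assoc) (blast intro: ar)+
  moreover have "\<exists>c. bi_arrow G (Suc n) c (?c f (?c f' g')) (?c (?c f f') g')"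
    by (rule bi_arrow_assoc) (blast intro: ar)+
  moreover have "\<exists>c. bi_arrow G (Suc n) c (?c (?c f f') g') (?c (idc G n y) g')"
    by (rule bi_arrow_whisker_right[OF a]) (blast intro: ar)+
  ultimately have "\<exists>c. bi_arrow G (Suc n) c (?c f (?c f' g')) g'"
    and 1: "\<exists>c. bi_arrow G (Suc n) c (?c (?c g f) (?c f' g')) (?c g (?c f (?c f' g')))"
    using bi_arrow_lunit[OF g'] bi_arrow_trans by blast+
  then obtain d where d: "bi_arrow G (Suc n) d (?c f (?c f' g')) g'" by blast
  have "\<exists>c. bi_arrow G (Suc n) c (?c g (?c f (?c f' g'))) (?c g g')"
    by (rule bi_arrow_whisker_left[OF d]) (blast intro: ar)+
  with 1 b show ?thesis using bi_arrow_trans by blast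
qed

text \<open>The interchanger brings each factor next to its own inverse, \<open>a\<close> and
  \<open>b\<close> cancel both pairs simultaneously, and the resulting composite of identities maps
  to the identity on the composite.\<close>

lemma bi_arrow_cancel_Suc:
  assumes f: "arrow G m f x y" and f': "arrow G m f' y x"
    and g: "arrow G m g x' y'" and g': "arrow G m g' y' x'"
    and x: "composable G m n x' x" and y: "composable G m n y' y"
    and a: "bi_arrow G (Suc m) a (cmp G (Suc m) 0 f f') (idc G m y)"
    and b: "bi_arrow G (Suc m) b (cmp G (Suc m) 0 g g') (idc G m y')"
  shows "\<exists>c. bi_arrow G (Suc m) c
    (cmp G (Suc m) 0 (cmp G (Suc m) (Suc n) g f) (cmp G (Suc m) (Suc n) g' f'))
    (idc G m (cmp G m n y' y))"
proof -
  have "\<exists>c. bi_arrow G (Suc m) c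
    (cmp G (Suc m) 0 (cmp G (Suc m) (Suc n) g f) (cmp G (Suc m) (Suc n) g' f'))
    (cmp G (Suc m) (Suc n) (cmp G (Suc m) 0 g g') (cmp G (Suc m) 0 f f'))"
    using pre_category composable_Suc_if_arrows[OF f g x y] composable_Suc_if_arrows[OF f' g' y x]
      composable_0_if_arrows[OF f' f] composable_0_if_arrows[OF g' g]
    unfolding higher_pre_category_def has_interchangers_def
    by (blast intro: qi_arrow_imp_bi_arrow)
  moreover have "\<exists>c. bi_arrow G (Suc m) c
    (cmp G (Suc m) (Suc n) (cmp G (Suc m) 0 g g') (cmp G (Suc m) 0 f f'))
    (cmp G (Suc m) (Suc n) (idc G m y') (idc G m y))"
    \<comment> \<open>The boundaries of \<open>a\<close> and \<open>b\<close> are composed at index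
      \<open>Suc n\<close>, so \<open>b\<close> and \<open>a\<close> are composed at index
      \<open>Suc (Suc n)\<close>. The sources of these boundaries are \<open>y\<close> and
      \<open>y'\<close>, as are their targets.\<close>
    using bi_arrow_cmp_Suc[OF a b]
      composable_Suc_if_arrows[OF arrow_cmp_0[OF f' f] arrow_cmp_0[OF g' g] y y]
      composable_Suc_if_arrows[OF arrow_idc[OF arrow_ends(2)[OF f]] arrow_idc[OF arrow_ends(2)[OF g]] y y]
    by blast
  moreover have "\<exists>c. bi_arrow G (Suc m) c (cmp G (Suc m) (Suc n) (idc G m y') (idc G m y))
    (idc G m (cmp G m n y' y))"
    using pre_category y
    unfolding higher_pre_category_def has_identity_composites_def
    by (blast intro: qi_arrow_imp_bi_arrow)
  ultimately show ?thesis using bi_arrow_trans by blast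
qed

section \<open>The coinductive step\<close>

lemma bi_step_iff:
  "(\<exists>w. bi_step G (bi_closure G) m f w) \<longleftrightarrow> (\<exists>n x y f' f'' r l. m = Suc n \<and>
     arrow G n f x y \<and> arrow G n f' y x \<and> arrow G n f'' y x \<and>
     bi_arrow G (Suc n) r (cmp G (Suc n) 0 f f') (idc G n y) \<and>
     bi_arrow G (Suc n) l (cmp G (Suc n) 0 f'' f) (idc G n x))"
  unfolding bi_step_def bi_arrow_def split_paired_Ex prod.case by blast

lemma bi_closure_step: "bi_closure G m f \<Longrightarrow> \<exists>w. bi_step G (bi_closure G) m f w"
proof (induction rule: bi_closure.induct)
  case (base m f F)
  then show ?case
  proof cases
    case (1 n x y f' f'' r l R L)
    then show ?thesis
      by (intro exI[of _ "(f', f'', r, l)"]) (auto simp: bi_step_def intro: bi_closure.base)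
  qed
next
  case (comp m n g f)
  from comp.IH(2) obtain k x y f' f'' r l where m: "m = Suc k"
    and f: "arrow G k f x y" "arrow G k f' y x" "arrow G k f'' y x"
      "bi_arrow G (Suc k) r (cmp G (Suc k) 0 f f') (idc G k y)"
      "bi_arrow G (Suc k) l (cmp G (Suc k) 0 f'' f) (idc G k x)"
    unfolding bi_step_iff by blast
  from comp.IH(1) m obtain x' y' g' g'' r' l' where
    g: "arrow G k g x' y'" "arrow G k g' y' x'" "arrow G k g'' y' x'"
      "bi_arrow G (Suc k) r' (cmp G (Suc k) 0 g g') (idc G k y')"
      "bi_arrow G (Suc k) l' (cmp G (Suc k) 0 g'' g) (idc G k x')"
    unfolding bi_step_iff by blast
  show ?case
  proof (cases n)
    case 0
    then have "x' = y" using comp.hyps(1) m f g by (auto simp: arrow_def)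
    note g = g[unfolded this]
    have "\<exists>c. bi_arrow G (Suc k) c
        (cmp G (Suc k) 0 (cmp G (Suc k) 0 g f) (cmp G (Suc k) 0 f' g')) (idc G k y')"
      by (rule bi_arrow_cancel_0) (use f g in blast)+
    \<comment> \<open>Left cancellation is the same lemma with \<open>f''\<close> and
      \<open>g''\<close> as the outer and inner cells, and \<open>g\<close>, \<open>f\<close> as
      their right inverses.\<close>
    moreover have "\<exists>c. bi_arrow G (Suc k) c
        (cmp G (Suc k) 0 (cmp G (Suc k) 0 f'' g'') (cmp G (Suc k) 0 g f)) (idc G k x)"
      by (rule bi_arrow_cancel_0) (use f g in blast)+
    ultimately show ?thesis
      unfolding bi_step_iff m 0 using f g by (blast intro: arrow_cmp_0)
  next
    case (Suc i)
    then have xy: "composable G k i x' x" "composable G k i y' y"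
      using comp.hyps(1) m f g by (auto simp: arrow_def)
    show ?thesis
      unfolding bi_step_iff m Suc
      \<comment> \<open>Left cancellation again treats \<open>f\<close> and \<open>g\<close> as
        right inverses of \<open>f''\<close> and \<open>g''\<close>. Inverses run backwards, so the
        two boundary conditions in \<open>xy\<close> change places.\<close>
      using bi_arrow_cancel_Suc[OF f(1,2) g(1,2) xy f(4) g(4)]
        bi_arrow_cancel_Suc[OF f(3,1) g(3,1) xy(2,1) f(5) g(5)]
        arrow_cmp_Suc[OF f(1) g(1) xy] arrow_cmp_Suc[OF f(2) g(2) xy(2,1)]
        arrow_cmp_Suc[OF f(3) g(3) xy(2,1)]
      by blast
  qed
qed

end

theorem theorem13:
  fixes G :: "'a higher_data"
    and m n :: nat
    and f g :: 'a
    and F K :: "'a bi_structure"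
  assumes "higher_pre_category G"
    and "composable G m n g f"
    and "bi_invertible G m f F"
    and "bi_invertible G m g K"
  shows "\<exists>H. bi_invertible G m (cmp G m n g f) H"
proof (rule bi_invertible_coinduct_ex)
  show "bi_closure G m (cmp G m n g f)"
    using assms(2-4) by (blast intro: bi_closure.intros)
  interpret pre_category_cells G using assms(1) by unfold_locales
  show "\<And>m f. bi_closure G m f \<Longrightarrow> \<exists>w. bi_step G (bi_closure G) m f w"
    by (rule bi_closure_step)
qed

end
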